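(* Let $l_P^C(\mathbf{\Theta}) = l(\mathbf{\Theta}) - P(\boldsymbol{\pi};\lambda)$ be the penalized log-likelihood of the PMoEP model, where $l(\mathbf{\Theta})=\log\sum_{\mathbf{Z}}\mathbb{P}(\mathbf{E},\mathbf{Z};\mathbf{\Theta})$. Let $\{\mathbf{\Theta}^{(t)}\}_{t\ge 0}$, $\mathbf{\Theta}^{(t)}=\{\boldsymbol{\pi}^{(t)},\boldsymbol{\eta}^{(t)},\mathbf{U}^{(t)},\mathbf{V}^{(t)}\}$, be the sequence generated by the EM algorithm for the PMoEP model, that is, for every $t\ge 1$, $$\mathbf{\Theta}^{(t)}=\underset{\mathbf{\Theta}}{\arg\max}\left\{\Omega(\mathbf{\Theta}|\mathbf{\Theta}^{(t-1)})+P(\boldsymbol{\pi}^{(t-1)};\lambda)-P(\boldsymbol{\pi};\lambda)\right\},$$ where $$\Omega(\mathbf{\Theta}|\mathbf{\Theta}^{(t-1)})=\sum_{\mathbf{Z}}\mathbb{P}(\mathbf{Z}|\mathbf{E};\mathbf{\Theta}^{(t-1)})\log\frac{\mathbb{P}(\mathbf{E},\mathbf{Z};\mathbf{\Theta})}{\mathbb{P}(\mathbf{E},\mathbf{Z};\mathbf{\Theta}^{(t-1)})}.$$ Assume that the sequence of values $\{l_P^C(\mathbf{\Theta}^{(t)})\}$ is bounded above. Then there exists a constant $l^{\star}$ such that $$\lim_{t\to\infty} l_P^C(\mathbf{\Theta}^{(t)}) = l^{\star}.$$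
   Context: Setting (PMoEP model: penalized mixture of exponential power distributions for low-rank matrix factorization). Let $\mathbf{Y}=(y_{ij})\in\mathbb{R}^{m\times n}$ be a data matrix, $\Omega$ (as a set) the index set of its non-missing entries, $r<\min(m,n)$ a fixed rank, $K\ge 1$ a number of mixture components, and $p_1,\dots,p_K>0$ fixed shape parameters. The parameter is $\mathbf{\Theta}=\{\boldsymbol{\pi},\boldsymbol{\eta},\mathbf{U},\mathbf{V}\}$, where $\boldsymbol{\pi}=(\pi_1,\dots,\pi_K)$ with $\pi_k\ge 0$, $\sum_k\pi_k=1$; $\boldsymbol{\eta}=(\eta_1,\dots,\eta_K)$ with $\eta_k>0$; $\mathbf{U}\in\mathbb{R}^{m\times r}$ with rows $\mathbf{u}_i$, and $\mathbf{V}\in\mathbb{R}^{n\times r}$ with rows $\mathbf{v}_j$. The noise is $e_{ij}=y_{ij}-\mathbf{u}_i\mathbf{v}_j^T$, $\mathbf{E}=(e_{ij})$; thus the likelihoods below depend on $\mathbf{U},\mathbf{V}$ through $\mathbf{E}$, with $\mathbf{Y}$ fixed, so that each occurrence of a likelihood at a parameter value uses the residuals computed from that parameter value. The exponential power density is $f_p(e;0,\eta)=\frac{p\,\eta^{1/p}}{2\Gamma(1/p)}\exp\{-\eta|e|^p\}$. The latent variables are $\mathbf{Z}=(\mathbf{z}_{ij})$ with $\mathbf{z}_{ij}=(z_{ij1},\dots,z_{ijK})$, $z_{ijk}\in\{0,1\}$, $\sum_k z_{ijk}=1$. The complete likelihood is $$\mathbb{P}(\mathbf{E},\mathbf{Z};\mathbf{\Theta})=\prod_{(i,j)\in\Omega}\prod_{k=1}^K[\pi_k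 f_{p_k}(e_{ij};0,\eta_k)]^{z_{ijk}},$$ $\mathbb{P}(\mathbf{E};\mathbf{\Theta})=\sum_{\mathbf{Z}}\mathbb{P}(\mathbf{E},\mathbf{Z};\mathbf{\Theta})$ (sum over all configurations of $\mathbf{z}_{ij}$, $(i,j)\in\Omega$), and $\mathbb{P}(\mathbf{Z}|\mathbf{E};\mathbf{\Theta})=\mathbb{P}(\mathbf{E},\mathbf{Z};\mathbf{\Theta})/\mathbb{P}(\mathbf{E};\mathbf{\Theta})$. The penalty is $$P(\boldsymbol{\pi};\lambda)=n\lambda\sum_{k=1}^K D_k\log\frac{\epsilon+\pi_k}{\epsilon},$$ where $\epsilon>0$ is a (small) constant, $\lambda>0$ is a tuning parameter and $D_k=2$ is the number of free parameters of the $k$-th component. Conventions: in sums over $\mathbf{Z}$ weighted by $\mathbb{P}(\mathbf{Z}|\mathbf{E};\mathbf{\Theta}^{(t-1)})$, terms of zero weight are taken to be $0$. The symbol $\Omega(\cdot|\cdot)$ denotes the function defined in the claim, not the index set. The $\arg\max$ is over the whole parameter set, i.e. over all $\mathbf{\Theta}=\{\boldsymbol{\pi},\boldsymbol{\eta},\mathbf{U},\mathbf{V}\}$ with $\pi_k\ge 0$, $\sum_{k=1}^K\pi_k=1$, $\eta_k>0$ for $k=1,\dots,K$, $\mathbf{U}\in\mathbb{R}^{m\times r}$ and $\mathbf{V}\in\mathbb{R}^{n\times r}$, and $\mathbf{\Theta}^{(t)}$ denotes a maximizer. *)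

theory Defs
  imports "HOL-Analysis.Analysis"
begin

text \<open>The index types \<open>'m\<close>, \<open>'n\<close>, \<open>'r\<close>, \<open>'k\<close> have $m$, $n$, $r$, $K$ elements. An element of
  \<^typ>\<open>real^'n^'m\<close> is an $m \times n$ matrix, and \<open>A $ i\<close> is its $i$-th row.\<close>

record ('m, 'n, 'r, 'k) pmoep_param =
  weights :: "real^'k"
  etas :: "real^'k"
  Umat :: "real^'r^'m"
  Vmat :: "real^'r^'n"

definition param_space :: "('m::finite, 'n::finite, 'r::finite, 'k::finite) pmoep_param set" where
  "param_space = {\<theta>. (\<forall>k. weights \<theta> $ k \<ge> 0) \<and> (\<Sum>k\<in>UNIV. weights \<theta> $ k) = 1 \<and>
                      (\<forall>k. etas \<theta> $ k > 0)}"

definition residual ::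
  "real^'n^'m \<Rightarrow> ('m::finite, 'n::finite, 'r::finite, 'k::finite) pmoep_param \<Rightarrow> real^'n^'m" where
  "residual Y \<theta> = (\<chi> i j. Y $ i $ j - Umat \<theta> $ i \<bullet> Vmat \<theta> $ j)"

definition ep_density :: "real \<Rightarrow> real \<Rightarrow> real \<Rightarrow> real" where
  "ep_density p \<eta> e = p * \<eta> powr (1 / p) / (2 * Gamma (1 / p)) * exp (- \<eta> * \<bar>e\<bar> powr p)"

definition latent_vectors :: "('k::finite \<Rightarrow> nat) set" where
  "latent_vectors = {z. (\<forall>k. z k \<in> {0, 1}) \<and> (\<Sum>k\<in>UNIV. z k) = 1}"

text \<open>Configurations are extensional functions, so that each one is counted exactly once.\<close>

definition configs :: "('m::finite \<times> 'n::finite) set \<Rightarrow> ('m \<times> 'n \<Rightarrow> 'k::finite \<Rightarrow> nat) set" where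
  "configs \<Omega> = (\<Pi>\<^sub>E ij\<in>\<Omega>. latent_vectors)"

text \<open>The likelihoods take the data \<open>Y\<close> and compute the residuals from their own parameter value.\<close>

definition complete_lik ::
  "real^'n^'m \<Rightarrow> ('m \<times> 'n) set \<Rightarrow> real^'k \<Rightarrow> ('m \<times> 'n \<Rightarrow> 'k \<Rightarrow> nat) \<Rightarrow>
   ('m::finite, 'n::finite, 'r::finite, 'k::finite) pmoep_param \<Rightarrow> real" where
  "complete_lik Y \<Omega> p Z \<theta> =
     (\<Prod>(i, j)\<in>\<Omega>. \<Prod>k\<in>UNIV.
        (weights \<theta> $ k * ep_density (p $ k) (etas \<theta> $ k) (residual Y \<theta> $ i $ j)) ^ Z (i, j) k)"

definition marginal_lik ::
  "real^'n^'m \<Rightarrow> ('m \<times> 'n) set \<Rightarrow> real^'k \<Rightarrow>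
   ('m::finite, 'n::finite, 'r::finite, 'k::finite) pmoep_param \<Rightarrow> real" where
  "marginal_lik Y \<Omega> p \<theta> = (\<Sum>Z\<in>configs \<Omega>. complete_lik Y \<Omega> p Z \<theta>)"

definition posterior ::
  "real^'n^'m \<Rightarrow> ('m \<times> 'n) set \<Rightarrow> real^'k \<Rightarrow> ('m \<times> 'n \<Rightarrow> 'k \<Rightarrow> nat) \<Rightarrow>
   ('m::finite, 'n::finite, 'r::finite, 'k::finite) pmoep_param \<Rightarrow> real" where
  "posterior Y \<Omega> p Z \<theta> = complete_lik Y \<Omega> p Z \<theta> / marginal_lik Y \<Omega> p \<theta>"

definition log_lik ::
  "real^'n^'m \<Rightarrow> ('m \<times> 'n) set \<Rightarrow> real^'k \<Rightarrow>
   ('m::finite, 'n::finite, 'r::finite, 'k::finite) pmoep_param \<Rightarrow> real" where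
  "log_lik Y \<Omega> p \<theta> = ln (marginal_lik Y \<Omega> p \<theta>)"

definition free_params :: "'k \<Rightarrow> real" where
  "free_params k = 2"

definition penalty ::
  "real \<Rightarrow> real \<Rightarrow> ('m::finite, 'n::finite, 'r::finite, 'k::finite) pmoep_param \<Rightarrow> real" where
  "penalty \<epsilon> lam \<theta> =
     real CARD('n) * lam * (\<Sum>k\<in>UNIV. free_params k * ln ((\<epsilon> + weights \<theta> $ k) / \<epsilon>))"

definition penalized_log_lik ::
  "real^'n^'m \<Rightarrow> ('m \<times> 'n) set \<Rightarrow> real^'k \<Rightarrow> real \<Rightarrow> real \<Rightarrow>
   ('m::finite, 'n::finite, 'r::finite, 'k::finite) pmoep_param \<Rightarrow> real" where
  "penalized_log_lik Y \<Omega> p \<epsilon> lam \<theta> = log_lik Y \<Omega> p \<theta> - penalty \<epsilon> lam \<theta>"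

text \<open>A parameter value with some vanishing weight may give likelihood $0$ to a configuration of
  positive posterior weight; the logarithm there is $-\infty$, whereas \<open>ln 0 = 0\<close> in HOL.
  Hence the function maximized by the EM step is extended-real-valued. The value $+\infty$ does not
  occur, so the sums and differences below are never of the form $\infty - \infty$.\<close>

definition ext_log :: "real \<Rightarrow> ereal" where
  "ext_log x = (if x > 0 then ereal (ln x) else - \<infinity>)"

definition em_surrogate ::
  "real^'n^'m \<Rightarrow> ('m \<times> 'n) set \<Rightarrow> real^'k \<Rightarrow>
   ('m::finite, 'n::finite, 'r::finite, 'k::finite) pmoep_param \<Rightarrow>
   ('m, 'n, 'r, 'k) pmoep_param \<Rightarrow> ereal" where
  "em_surrogate Y \<Omega> p \<theta> \<theta>' =
     (\<Sum>Z\<in>configs \<Omega>.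
        if posterior Y \<Omega> p Z \<theta>' = 0 then 0
        else ereal (posterior Y \<Omega> p Z \<theta>') *
             ext_log (complete_lik Y \<Omega> p Z \<theta> / complete_lik Y \<Omega> p Z \<theta>'))"

definition em_objective ::
  "real^'n^'m \<Rightarrow> ('m \<times> 'n) set \<Rightarrow> real^'k \<Rightarrow> real \<Rightarrow> real \<Rightarrow>
   ('m::finite, 'n::finite, 'r::finite, 'k::finite) pmoep_param \<Rightarrow>
   ('m, 'n, 'r, 'k) pmoep_param \<Rightarrow> ereal" where
  "em_objective Y \<Omega> p \<epsilon> lam \<theta> \<theta>' =
     em_surrogate Y \<Omega> p \<theta> \<theta>' + ereal (penalty \<epsilon> lam \<theta>') - ereal (penalty \<epsilon> lam \<theta>)"

definition em_sequence ::
  "real^'n^'m \<Rightarrow> ('m \<times> 'n) set \<Rightarrow> real^'k \<Rightarrow> real \<Rightarrow> real \<Rightarrow>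
   (nat \<Rightarrow> ('m::finite, 'n::finite, 'r::finite, 'k::finite) pmoep_param) \<Rightarrow> bool" where
  "em_sequence Y \<Omega> p \<epsilon> lam \<Theta> \<longleftrightarrow>
     \<Theta> 0 \<in> param_space \<and>
     (\<forall>t\<ge>1. is_arg_max (\<lambda>\<theta>. em_objective Y \<Omega> p \<epsilon> lam \<theta> (\<Theta> (t - 1))) (\<lambda>\<theta>. \<theta> \<in> param_space) (\<Theta> t))"

end

theory Submission
  imports Defs
begin

text \<open>With \<open>c\<close> the ratio of the marginal likelihoods at the new and the old parameter value and
  \<open>q\<close> the ratio of the complete likelihoods of a configuration, the tangent inequality
  $\ln (q/c) \le q/c - 1$ bounds the surrogate termwise; summing against the posterior gives
  $\ln c$, the increase of the log-likelihood. The EM objective vanishes at the old parameter value,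
  hence is nonnegative at a maximizer, so the penalized log-likelihood increases along the sequence.\<close>

lemma finite_latent_vectors: "finite (latent_vectors :: ('k::finite \<Rightarrow> nat) set)"
proof (rule finite_subset)
  show "(latent_vectors :: ('k \<Rightarrow> nat) set) \<subseteq> (\<Pi>\<^sub>E k\<in>UNIV. {0, 1})"
    unfolding latent_vectors_def PiE_UNIV_domain by blast
qed (auto intro: finite_PiE)

lemma finite_configs: "finite (configs \<Omega>)"
  unfolding configs_def by (auto intro: finite_PiE finite_latent_vectors)

lemma ep_density_pos:
  assumes "p > 0" "\<eta> > 0"
  shows "ep_density p \<eta> e > 0"
  using assms by (auto simp: ep_density_def intro!: mult_pos_pos divide_pos_pos Gamma_real_pos)

context
  fixes Y :: "real^'n::finite^'m::finite" and \<Omega> :: "('m \<times> 'n) set" and p :: "real^'k::finite"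
  assumes shape_pos: "\<And>k. p $ k > 0"
begin

lemma complete_lik_nonneg:
  assumes "\<theta> \<in> param_space"
  shows "complete_lik Y \<Omega> p Z \<theta> \<ge> 0"
proof -
  have "ep_density (p $ k) (etas \<theta> $ k) e \<ge> 0" for k e
    using assms shape_pos by (auto simp: param_space_def intro!: less_imp_le[OF ep_density_pos])
  then show ?thesis
    using assms unfolding complete_lik_def
    by (auto simp: param_space_def intro!: prod_nonneg)
qed

text \<open>The weights sum to 1, so some component has positive weight, and putting every entry
  into it gives a positive term of the sum. Positivity makes \<open>ln\<close> of the marginal
  likelihood and division by it genuine.\<close>

lemma marginal_lik_pos:
  assumes "\<theta> \<in> param_space"
  shows "marginal_lik Y \<Omega> p \<theta> > 0"
proof -
  obtain k where "weights \<theta> $ k \<noteq> 0"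
    using assms unfolding param_space_def by (metis (mono_tags, lifting) mem_Collect_eq sum.neutral zero_neq_one)
  then have k: "weights \<theta> $ k > 0"
    using assms by (simp add: param_space_def order_less_le)
  \<comment> \<open>The restriction to \<open>\<Omega>\<close> makes \<open>Z\<close> extensional,
    as membership in \<open>configs\<close> demands.\<close>
  define Z where "Z = (\<lambda>ij\<in>\<Omega>. \<lambda>l. if l = k then 1 else 0 :: nat)"
  have Z: "Z \<in> configs \<Omega>"
    by (auto simp: Z_def configs_def latent_vectors_def)
  have "complete_lik Y \<Omega> p Z \<theta> > 0"
    using k assms shape_pos unfolding complete_lik_def
    by (auto simp: Z_def param_space_def intro!: prod_pos ep_density_pos mult_pos_pos)
  then show ?thesis
    unfolding marginal_lik_def using Z assms
    by (intro sum_pos2[of _ Z]) (auto simp: finite_configs complete_lik_nonneg)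
qed

lemma sum_posterior:
  assumes "\<theta> \<in> param_space"
  shows "(\<Sum>Z\<in>configs \<Omega>. posterior Y \<Omega> p Z \<theta>) = 1"
  using marginal_lik_pos[OF assms]
  by (simp add: posterior_def marginal_lik_def flip: sum_divide_distrib)

lemma em_surrogate_le:
  assumes "\<theta> \<in> param_space" and "\<theta>' \<in> param_space"
  shows "em_surrogate Y \<Omega> p \<theta> \<theta>' \<le> ereal (log_lik Y \<Omega> p \<theta> - log_lik Y \<Omega> p \<theta>')"
proof -
  define M M' where "M = marginal_lik Y \<Omega> p \<theta>" and "M' = marginal_lik Y \<Omega> p \<theta>'"
  have M: "M > 0" and M': "M' > 0"
    using assms by (auto simp: M_def M'_def marginal_lik_pos)
  \<comment> \<open>The posterior times the tangent bound \<open>ln c + q / c - 1\<close>, with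
    \<open>c = M / M'\<close>. The posterior cancels the old complete likelihood in
    \<open>q / c\<close>, so the last summand keeps a meaning where that likelihood is 0.\<close>
  define b where
    "b Z = posterior Y \<Omega> p Z \<theta>' * (ln (M / M') - 1) + complete_lik Y \<Omega> p Z \<theta> / M" for Z
  have "(if posterior Y \<Omega> p Z \<theta>' = 0 then 0
         else ereal (posterior Y \<Omega> p Z \<theta>') *
              ext_log (complete_lik Y \<Omega> p Z \<theta> / complete_lik Y \<Omega> p Z \<theta>')) \<le> ereal (b Z)"
    (is "?term \<le> _") for Z
  proof -
    define L L' where "L = complete_lik Y \<Omega> p Z \<theta>" and "L' = complete_lik Y \<Omega> p Z \<theta>'"
    have post: "posterior Y \<Omega> p Z \<theta>' = L' / M'"
      by (simp add: posterior_def L'_def M'_def)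
    have L: "L \<ge> 0" and L': "L' \<ge> 0"
      using assms by (auto simp: L_def L'_def complete_lik_nonneg)
    consider "L' = 0" | "L' > 0" "L = 0" | "L' > 0" "L > 0"
      using L L' by linarith
    then show ?thesis
    proof cases
      \<comment> \<open>The weight is zero, so the term is 0 by convention, while \<open>b Z\<close>
        reduces to \<open>L / M\<close>, which is nonnegative and may be positive.\<close>
      case 1
      then show ?thesis using M L by (simp add: post b_def flip: L_def)
    next
      \<comment> \<open>A positive posterior multiplies the logarithm of 0, so the term is minus
        infinity.\<close>
      case 2
      then show ?thesis using M'
        by (simp add: post ext_log_def flip: L_def L'_def)
    next
      case 3
      have "ln (L / L') = ln (M / M') + ln (L / L' / (M / M'))"
        using 3 M M' by (simp add: ln_div ln_mult)
      also have "\<dots> \<le> ln (M / M') + (L / L' / (M / M') - 1)"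
        using 3 M M' by (intro add_left_mono ln_le_minus_one divide_pos_pos)
      finally have "L' / M' * ln (L / L') \<le> L' / M' * (ln (M / M') + (L / L' / (M / M') - 1))"
        using 3 M' by (intro mult_left_mono) auto
      also have "\<dots> = b Z"
        using 3 M M' by (simp add: b_def post field_simps flip: L_def)
      finally show ?thesis
        using 3 M' by (simp add: post ext_log_def flip: L_def L'_def)
    qed
  qed
  then have "em_surrogate Y \<Omega> p \<theta> \<theta>' \<le> (\<Sum>Z\<in>configs \<Omega>. ereal (b Z))"
    unfolding em_surrogate_def by (intro sum_mono)
  also have "\<dots> = ereal (\<Sum>Z\<in>configs \<Omega>. b Z)"
    by simp
  \<comment> \<open>The posteriors sum to 1 and the complete likelihoods at \<open>\<theta>\<close>
    sum to \<open>M\<close>, so \<open>M / M\<close> will cancel the \<open>- 1\<close>.\<close>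
  also have "(\<Sum>Z\<in>configs \<Omega>. b Z) = ln (M / M') - 1 + M / M"
    using sum_posterior[OF assms(2)]
    by (simp add: b_def sum.distrib M_def marginal_lik_def flip: sum_distrib_right sum_divide_distrib)
  also have "\<dots> = log_lik Y \<Omega> p \<theta> - log_lik Y \<Omega> p \<theta>'"
    using M M' by (simp add: ln_div log_lik_def flip: M_def M'_def)
  finally show ?thesis .
qed

text \<open>A nonzero posterior forces a nonzero complete likelihood, so its ratio with itself is 1
  and has logarithm 0; the remaining terms vanish by convention, and the penalties cancel.\<close>

lemma em_objective_self:
  assumes "\<theta> \<in> param_space"
  shows "em_objective Y \<Omega> p \<epsilon> lam \<theta> \<theta> = 0"
proof -
  have "em_surrogate Y \<Omega> p \<theta> \<theta> = 0"
    unfolding em_surrogate_def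
    by (intro sum.neutral) (auto simp: ext_log_def posterior_def)
  then show ?thesis
    by (simp add: em_objective_def)
qed

lemma em_objective_le:
  assumes "\<theta> \<in> param_space" and "\<theta>' \<in> param_space"
  shows "em_objective Y \<Omega> p \<epsilon> lam \<theta> \<theta>' \<le>
    ereal (penalized_log_lik Y \<Omega> p \<epsilon> lam \<theta> - penalized_log_lik Y \<Omega> p \<epsilon> lam \<theta>')"
proof -
  have "em_objective Y \<Omega> p \<epsilon> lam \<theta> \<theta>' \<le>
      ereal (log_lik Y \<Omega> p \<theta> - log_lik Y \<Omega> p \<theta>') + ereal (penalty \<epsilon> lam \<theta>') - ereal (penalty \<epsilon> lam \<theta>)"
    unfolding em_objective_def
    by (intro ereal_minus_mono add_right_mono em_surrogate_le assms order_refl)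
  then show ?thesis
    by (simp add: penalized_log_lik_def algebra_simps)
qed

lemma em_sequence_mono:
  assumes em: "em_sequence Y \<Omega> p \<epsilon> lam \<Theta>"
  shows "incseq (\<lambda>t. penalized_log_lik Y \<Omega> p \<epsilon> lam (\<Theta> t))"
proof (rule incseq_SucI)
  fix t
  have step: "is_arg_max (\<lambda>\<theta>. em_objective Y \<Omega> p \<epsilon> lam \<theta> (\<Theta> t)) (\<lambda>\<theta>. \<theta> \<in> param_space) (\<Theta> (Suc t))"
    for t
    using em unfolding em_sequence_def by (metis diff_Suc_1 le_add1 plus_1_eq_Suc)
  \<comment> \<open>The initial value is feasible by definition, every later one as a maximizer over
    \<open>param_space\<close>.\<close>
  have space: "\<Theta> t \<in> param_space" for t
    using em step by (cases t) (auto simp: em_sequence_def is_arg_max_def)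
  have "0 = em_objective Y \<Omega> p \<epsilon> lam (\<Theta> t) (\<Theta> t)"
    by (simp add: em_objective_self space)
  also have "\<dots> \<le> em_objective Y \<Omega> p \<epsilon> lam (\<Theta> (Suc t)) (\<Theta> t)"
    \<comment> \<open>\<open>is_arg_max\<close> only excludes strictly larger values; linearity of
      the order on \<open>ereal\<close> turns this into an upper bound.\<close>
    using step[of t] space[of t] by (auto simp: is_arg_max_def not_less)
  also have "\<dots> \<le> ereal (penalized_log_lik Y \<Omega> p \<epsilon> lam (\<Theta> (Suc t)) -
                          penalized_log_lik Y \<Omega> p \<epsilon> lam (\<Theta> t))"
    by (intro em_objective_le space)
  finally show "penalized_log_lik Y \<Omega> p \<epsilon> lam (\<Theta> t) \<le> penalized_log_lik Y \<Omega> p \<epsilon> lam (\<Theta> (Suc t))"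
    by simp
qed

end

theorem mainTheorem1:
  fixes Y :: "real^'n::finite^'m::finite"
    and \<Omega> :: "('m \<times> 'n) set"
    and p :: "real^'k::finite"
    and \<epsilon> lam :: real
    and \<Theta> :: "nat \<Rightarrow> ('m, 'n, 'r::finite, 'k) pmoep_param"
  assumes rank: "CARD('r) < min CARD('m) CARD('n)"
    and shape_pos: "\<And>k. p $ k > 0"
    and eps_pos: "\<epsilon> > 0"
    and lambda_pos: "lam > 0"
    and em: "em_sequence Y \<Omega> p \<epsilon> lam \<Theta>"
    and bounded: "bdd_above (range (\<lambda>t. penalized_log_lik Y \<Omega> p \<epsilon> lam (\<Theta> t)))"
  shows "\<exists>l :: real. (\<lambda>t. penalized_log_lik Y \<Omega> p \<epsilon> lam (\<Theta> t)) \<longlonglongrightarrow> l"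
  \<comment> \<open>Monotone convergence: the limit is the supremum of the values.\<close>
  using LIMSEQ_incseq_SUP[OF bounded em_sequence_mono[OF shape_pos em]] by blast

end
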